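(* Let $k\ge1$, $1\le t\le k$, and let $G=(X,Y,E)$ be a simple $n$-vertex $d$-regular bipartite graph with adjacency eigenvalues $\lambda_1\ge\cdots\ge\lambda_n$ and $\lambda=\lambda(G)=\max\{\lambda_2,|\lambda_{n-1}|\}$ (the third largest eigenvalue in absolute value). Let $\Lambda$ be the third largest eigenvalue in absolute value of $BGP_{k,t}(G)$, i.e. if $\Psi_1\ge\cdots\ge\Psi_N$ are its eigenvalues, $\Lambda=\max\{\Psi_2,|\Psi_{N-1}|\}$. Let $$d_2=\sum_{t'=t}^k \binom{k}{t'}d^{t'}\left(\frac n2-d\right)^{k-t'},\qquad \alpha=\sum_{\ell=0}^{k-t}\frac{\binom{k-t}{\ell}}{\binom{t+\ell}{\ell}}.$$ If $d\le n/4$, then $$\frac{\lambda}{d}\cdot\frac{1}{\alpha}\cdot\frac{t}{k}\cdot d_2\le\Lambda\le\frac{\lambda}{d}\cdot d_2.$$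
   Context: For a simple bipartite graph $G=(X,Y,E)$, $BGP_{k,t}(G)$ is the bipartite graph with vertex classes $X^k$ and $Y^k$ in which $(x_1,\ldots,x_k)\in X^k$ and $(y_1,\ldots,y_k)\in Y^k$ are adjacent iff there are at least $t$ indices $i$ with $\{x_i,y_i\}\in E$. Eigenvalues are those of the adjacency matrix. *)

theory Defs
  imports
    "Jordan_Normal_Form.Char_Poly"
    "HOL-Library.Multiset"
begin

definition bipartite_graph :: "'a set \<Rightarrow> 'a set \<Rightarrow> 'a set set \<Rightarrow> bool" where
  "bipartite_graph X Y E \<longleftrightarrow>
     finite X \<and> finite Y \<and> X \<inter> Y = {} \<and> E \<subseteq> {{x, y} | x y. x \<in> X \<and> y \<in> Y}"

definition regular_graph :: "'a set \<Rightarrow> 'a set set \<Rightarrow> nat \<Rightarrow> bool" where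
  "regular_graph V E d \<longleftrightarrow> (\<forall>v\<in>V. card {u \<in> V. {v, u} \<in> E} = d)"

text \<open>
  The rows and columns of the adjacency matrix are ordered by an arbitrary enumeration of the
  vertices. Another enumeration conjugates the matrix by a permutation matrix, so the
  characteristic polynomial does not depend on the choice.
\<close>

definition vertex_list :: "'a set \<Rightarrow> 'a list" where
  "vertex_list V = (SOME vs. distinct vs \<and> set vs = V)"

definition adjacency_matrix :: "'a set \<Rightarrow> 'a set set \<Rightarrow> real mat" where
  "adjacency_matrix V E =
     mat (card V) (card V)
       (\<lambda>(i, j). if {vertex_list V ! i, vertex_list V ! j} \<in> E then 1 else 0)"

text \<open>
  The matrix is real symmetric, so its characteristic polynomial splits over the reals and the
  spectrum below has exactly one entry for each vertex. It is sorted in decreasing order, and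
  \<open>graph_eigenvalue\<close> counts from 1.
\<close>

definition graph_spectrum :: "'a set \<Rightarrow> 'a set set \<Rightarrow> real list" where
  "graph_spectrum V E =
     rev (sorted_list_of_multiset (proots (char_poly (adjacency_matrix V E))))"

definition graph_eigenvalue :: "'a set \<Rightarrow> 'a set set \<Rightarrow> nat \<Rightarrow> real" where
  "graph_eigenvalue V E i = graph_spectrum V E ! (i - 1)"

definition third_abs_eigenvalue :: "'a set \<Rightarrow> 'a set set \<Rightarrow> real" where
  "third_abs_eigenvalue V E =
     max (graph_eigenvalue V E 2) \<bar>graph_eigenvalue V E (card V - 1)\<bar>"

definition tuples :: "nat \<Rightarrow> 'a set \<Rightarrow> 'a list set" where
  "tuples k X = {xs. length xs = k \<and> set xs \<subseteq> X}"

text \<open>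
  The graph \<open>BGP\<^bsub>k,t\<^esub>(G)\<close> has vertex classes \<open>tuples k X\<close> and \<open>tuples k Y\<close> and the
  following edges.
\<close>

definition bgp_edges :: "nat \<Rightarrow> nat \<Rightarrow> 'a set \<Rightarrow> 'a set \<Rightarrow> 'a set set \<Rightarrow> 'a list set set" where
  "bgp_edges k t X Y E =
     {{xs, ys} | xs ys. xs \<in> tuples k X \<and> ys \<in> tuples k Y \<and>
        t \<le> card {i. i < k \<and> {xs ! i, ys ! i} \<in> E}}"

end

theory Submission
  imports Defs "HOL-Analysis.Function_Topology"
begin

text \<open>
  Let \<open>m = n/2\<close> and let \<open>B\<close> be the biadjacency matrix of \<open>G\<close>. The eigenvalues of a bipartite graph are
  plus and minus the singular values of its biadjacency matrix. Regularity gives a singular value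
  decomposition of \<open>B\<close> that contains the constant vectors with singular value \<open>d\<close>; the same vectors
  decompose the complement \<open>J - B\<close>, with values \<open>m - d\<close> for the constant vectors and \<open>-\<sigma>\<^sub>i\<close> otherwise.
  Hence tensor products of these vectors decompose the biadjacency matrix of \<open>BGP\<^bsub>k,t\<^esub>(G)\<close>, and the
  value at an index tuple is the sum of the coefficients of \<open>z\<^sup>a\<close>, \<open>a \<ge> t\<close>, in the product of the
  linear factors \<open>c\<^sub>i + b\<^sub>i z\<close>, where \<open>b\<^sub>i\<close> and \<open>c\<^sub>i\<close> are the values of \<open>B\<close> and \<open>J - B\<close>.

  A nonconstant index contributes the factor \<open>\<sigma>\<^sub>i (z - 1)\<close>, and the factor \<open>z - 1\<close> collapses the tail sum to a
  single coefficient. As \<open>d \<le> m - d\<close>, that coefficient is at most the one of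
  \<open>(m - d + d z)\<^sup>k\<^sup>-\<^sup>1\<close>, so \<open>\<Lambda> = \<lambda> (k-1 choose t-1) d\<^sup>t\<^sup>-\<^sup>1 (m-d)\<^sup>k\<^sup>-\<^sup>t\<close> exactly. The two bounds compare
  \<open>d\<^sub>2\<close> with its first summand.
\<close>

subsection \<open>Singular systems\<close>

definition orthonormal_family :: "'a set \<Rightarrow> 'i set \<Rightarrow> ('i \<Rightarrow> 'a \<Rightarrow> real) \<Rightarrow> bool" where
  "orthonormal_family X I u \<longleftrightarrow>
     (\<forall>i\<in>I. \<forall>j\<in>I. (\<Sum>x\<in>X. u i x * u j x) = (if i = j then 1 else 0))"

lemma orthonormal_familyD:
  "orthonormal_family X I u \<Longrightarrow> i \<in> I \<Longrightarrow> j \<in> I \<Longrightarrow>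
     (\<Sum>x\<in>X. u i x * u j x) = (if i = j then 1 else 0)"
  by (simp add: orthonormal_family_def)

text \<open>The values may have either sign, unlike singular values proper. This lets
  \<open>B\<close> and its complement share \<open>u\<close> and \<open>v\<close>, with opposite
  values at the nonconstant indices.\<close>

definition singular_system ::
  "'a set \<Rightarrow> 'b set \<Rightarrow> ('a \<Rightarrow> 'b \<Rightarrow> real) \<Rightarrow> 'i set \<Rightarrow> ('i \<Rightarrow> real) \<Rightarrow>
     ('i \<Rightarrow> 'a \<Rightarrow> real) \<Rightarrow> ('i \<Rightarrow> 'b \<Rightarrow> real) \<Rightarrow> bool" where
  "singular_system X Y B I \<sigma> u v \<longleftrightarrow>
     orthonormal_family X I u \<and> orthonormal_family Y I v \<and>
     (\<forall>i\<in>I. \<forall>x\<in>X. (\<Sum>y\<in>Y. B x y * v i y) = \<sigma> i * u i x) \<and>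
     (\<forall>i\<in>I. \<forall>y\<in>Y. (\<Sum>x\<in>X. B x y * u i x) = \<sigma> i * v i y)"

lemma singular_system_transpose:
  "singular_system X Y B I \<sigma> u v \<Longrightarrow> singular_system Y X (\<lambda>y x. B x y) I \<sigma> v u"
  by (simp add: singular_system_def)

lemma normalize_function:
  fixes f :: "'a \<Rightarrow> real"
  assumes "(\<Sum>x\<in>X. (f x)\<^sup>2) = c" and "c > 0"
  shows "(\<Sum>x\<in>X. (f x / sqrt c)\<^sup>2) = 1"
proof -
  have "(\<Sum>x\<in>X. (f x / sqrt c)\<^sup>2) = (\<Sum>x\<in>X. (f x)\<^sup>2) / c"
    using assms(2) by (simp add: power_divide sum_divide_distrib)
  then show ?thesis using assms by simp
qed

text \<open>Functions are total, so they are set to zero off \<open>X\<close>, where the norm does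
  not control them. This makes the set compact in the product topology.\<close>

definition unit_orthogonal :: "'a set \<Rightarrow> nat \<Rightarrow> (nat \<Rightarrow> 'a \<Rightarrow> real) \<Rightarrow> ('a \<Rightarrow> real) set" where
  "unit_orthogonal X r u =
     {a. (\<forall>x. x \<notin> X \<longrightarrow> a x = 0) \<and> (\<Sum>x\<in>X. (a x)\<^sup>2) = 1 \<and> (\<forall>i<r. (\<Sum>x\<in>X. u i x * a x) = 0)}"

text \<open>
  If every indicator function lay in the span of the family, summing the squared norms
  \<open>\<Sum>i<r. (u i x)\<^sup>2\<close> of their projections over all points would give \<open>card X = r\<close>.
\<close>

lemma unit_orthogonal_nonempty:
  assumes fin: "finite X" and on: "orthonormal_family X {..<r} u" and r: "r < card X"
  shows "unit_orthogonal X r u \<noteq> {}"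
proof -
  have "(\<Sum>x\<in>X. \<Sum>i<r. (u i x)\<^sup>2) = (\<Sum>i<r. \<Sum>x\<in>X. (u i x)\<^sup>2)"
    by (rule sum.swap)
  also have "\<dots> = (\<Sum>i<r. 1)"
    using orthonormal_familyD[OF on] by (intro sum.cong) (auto simp: power2_eq_square)
  finally have tot: "(\<Sum>x\<in>X. \<Sum>i<r. (u i x)\<^sup>2) = real r" by simp
  obtain z where z: "z \<in> X" "(\<Sum>i<r. (u i z)\<^sup>2) \<noteq> 1"
  proof (rule ccontr)
    assume "\<not> thesis"
    with that have "\<And>z. z \<in> X \<Longrightarrow> (\<Sum>i<r. (u i z)\<^sup>2) = 1" by blast
    then have "(\<Sum>x\<in>X. \<Sum>i<r. (u i x)\<^sup>2) = (\<Sum>x\<in>X. 1)" by (intro sum.cong) auto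
    with tot r show False by simp
  qed
  \<comment> \<open>The indicator of \<open>z\<close> minus its projection onto the span of the
    family. Its value at \<open>z\<close> is 1 minus the squared norm of that projection, hence
    nonzero.\<close>
  define w where "w x = (if x \<in> X then (if x = z then 1 else 0) - (\<Sum>i<r. u i z * u i x) else 0)" for x
  have orth: "(\<Sum>x\<in>X. u j x * w x) = 0" if "j < r" for j
  proof -
    have "(\<Sum>x\<in>X. u j x * w x) = (\<Sum>x\<in>X. (if x = z then u j x else 0) - (\<Sum>i<r. u i z * (u i x * u j x)))"
      by (intro sum.cong) (auto simp: w_def algebra_simps sum_distrib_left)
    also have "\<dots> = u j z - (\<Sum>i<r. u i z * (\<Sum>x\<in>X. u i x * u j x))"
      using fin z by (simp add: sum_subtractf sum.swap[of _ X] sum_distrib_left sum.delta')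
    also have "(\<Sum>i<r. u i z * (\<Sum>x\<in>X. u i x * u j x)) = (\<Sum>i<r. if i = j then u j z else 0)"
      using orthonormal_familyD[OF on] that by (intro sum.cong) auto
    finally show ?thesis using that by simp
  qed
  define c where "c = (\<Sum>x\<in>X. (w x)\<^sup>2)"
  have "w z \<noteq> 0" using z by (simp add: w_def power2_eq_square)
  then have "0 < (w z)\<^sup>2" by simp
  also have "(w z)\<^sup>2 \<le> c" unfolding c_def using fin z by (intro member_le_sum) auto
  finally have c: "c > 0" .
  have "(\<Sum>x\<in>X. (w x / sqrt c)\<^sup>2) = 1"
    using c by (intro normalize_function) (simp_all add: c_def)
  moreover have "(\<Sum>x\<in>X. u i x * (w x / sqrt c)) = 0" if "i < r" for i
    using orth[OF that] by (simp flip: sum_divide_distrib)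
  ultimately have "(\<lambda>x. w x / sqrt c) \<in> unit_orthogonal X r u"
    by (simp add: unit_orthogonal_def w_def)
  then show ?thesis by blast
qed

text \<open>The set is closed and lies in a product of intervals \<open>{-1..1}\<close> and
  singletons \<open>{0}\<close>, which is compact by Tychonoff.\<close>

lemma compact_unit_orthogonal:
  assumes "finite X"
  shows "compact (unit_orthogonal X r u)"
proof -
  define S where "S x = (if x \<in> X then {-1..1::real} else {0})" for x
  have "compactin (product_topology (\<lambda>_. euclidean) UNIV) (PiE UNIV S)"
    by (subst compactin_PiE) (auto simp: S_def)
  then have S: "compact (PiE UNIV S)"
    by (simp add: euclidean_product_topology)
  have "closed {a :: 'a \<Rightarrow> real. (\<Sum>x\<in>X. (a x)\<^sup>2) = 1}"
    by (intro closed_Collect_eq continuous_intros continuous_on_product_coordinates)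
  moreover have "closed {a :: 'a \<Rightarrow> real. \<forall>i\<in>{..<r}. (\<Sum>x\<in>X. u i x * a x) = 0}"
    unfolding Collect_ball_eq
    by (intro closed_INT ballI closed_Collect_eq continuous_intros continuous_on_product_coordinates)
  ultimately have "compact (PiE UNIV S \<inter>
      ({a. (\<Sum>x\<in>X. (a x)\<^sup>2) = 1} \<inter> {a. \<forall>i\<in>{..<r}. (\<Sum>x\<in>X. u i x * a x) = 0}))"
    by (intro compact_Int_closed S closed_Int)
  also have "\<dots> = unit_orthogonal X r u"
  proof -
    have "a \<in> PiE UNIV S" if "a \<in> unit_orthogonal X r u" for a
    proof -
      have "\<bar>a x\<bar> \<le> 1" if "x \<in> X" for x
      proof -
        have "(a x)\<^sup>2 \<le> (\<Sum>x\<in>X. (a x)\<^sup>2)" using assms that by (intro member_le_sum) auto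
        also have "\<dots> = 1" using \<open>a \<in> unit_orthogonal X r u\<close> by (simp add: unit_orthogonal_def)
        finally show ?thesis by (simp add: abs_square_le_1)
      qed
      then show ?thesis using that by (auto simp: S_def PiE_iff unit_orthogonal_def abs_le_iff)
    qed
    then show ?thesis by (fastforce simp: unit_orthogonal_def PiE_iff S_def split: if_splits)
  qed
  finally show ?thesis .
qed

text \<open>Equality case of Cauchy-Schwarz. If \<open>q\<close> is not zero on \<open>X\<close>,
  its normalization is itself a competitor, so the norm of \<open>q\<close> is at most
  \<open>s\<close>. Expanding the squared norm of \<open>q - s a\<close> then leaves at most
  zero.\<close>

lemma linear_maximizer:
  assumes fin: "finite X" and a: "a \<in> unit_orthogonal X r u"
    and q: "\<And>i. i < r \<Longrightarrow> (\<Sum>x\<in>X. u i x * q x) = 0"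
    and max: "\<And>h. h \<in> unit_orthogonal X r u \<Longrightarrow> (\<Sum>x\<in>X. h x * q x) \<le> s"
    and s: "(\<Sum>x\<in>X. a x * q x) = s" and x: "x \<in> X"
  shows "q x = s * a x"
proof -
  define c where "c = (\<Sum>x\<in>X. (q x)\<^sup>2)"
  have c0: "c \<ge> 0" by (simp add: c_def sum_nonneg)
  have cs: "c \<le> s\<^sup>2"
  proof (cases "c = 0")
    case False
    with c0 have c: "c > 0" by simp
    define h where "h x = (if x \<in> X then q x / sqrt c else 0)" for x
    have "(\<Sum>x\<in>X. (h x)\<^sup>2) = (\<Sum>x\<in>X. (q x / sqrt c)\<^sup>2)" by (intro sum.cong) (auto simp: h_def)
    also have "\<dots> = 1" using c by (intro normalize_function) (simp_all add: c_def)
    finally have h1: "(\<Sum>x\<in>X. (h x)\<^sup>2) = 1" .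
    have h2: "(\<Sum>x\<in>X. u i x * h x) = 0" if "i < r" for i
    proof -
      have "(\<Sum>x\<in>X. u i x * h x) = (\<Sum>x\<in>X. u i x * q x) / sqrt c"
        unfolding sum_divide_distrib by (intro sum.cong) (auto simp: h_def)
      then show ?thesis using q[OF that] by simp
    qed
    have "h \<in> unit_orthogonal X r u" using h1 h2 by (simp add: unit_orthogonal_def h_def)
    from max[OF this] have "(\<Sum>x\<in>X. h x * q x) \<le> s" .
    also have "(\<Sum>x\<in>X. h x * q x) = c / sqrt c"
      unfolding sum_divide_distrib c_def
      by (intro sum.cong) (auto simp: h_def c_def power2_eq_square)
    finally have "sqrt c \<le> s" using c by (simp add: real_div_sqrt)
    then have "(sqrt c)\<^sup>2 \<le> s\<^sup>2" using c by (intro power_mono) auto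
    then show ?thesis using c by simp
  qed simp
  have "(\<Sum>x\<in>X. (q x - s * a x)\<^sup>2) =
      (\<Sum>x\<in>X. (q x)\<^sup>2) - 2 * s * (\<Sum>x\<in>X. a x * q x) + s\<^sup>2 * (\<Sum>x\<in>X. (a x)\<^sup>2)"
    by (simp add: power2_diff sum.distrib sum_subtractf sum_distrib_left power_mult_distrib algebra_simps)
  also have "\<dots> = c - s\<^sup>2"
    using a by (simp add: s c_def unit_orthogonal_def power2_eq_square)
  finally have "(\<Sum>x\<in>X. (q x - s * a x)\<^sup>2) \<le> 0" using cs by simp
  moreover have "(q x - s * a x)\<^sup>2 \<le> (\<Sum>x\<in>X. (q x - s * a x)\<^sup>2)"
    using fin x by (intro member_le_sum) auto
  ultimately have "(q x - s * a x)\<^sup>2 \<le> 0" by linarith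
  then show ?thesis by simp
qed

lemma orthonormal_family_extend:
  assumes on: "orthonormal_family X {..<r} u" and a: "a \<in> unit_orthogonal X r u"
  shows "orthonormal_family X {..<Suc r} (u(r := a))"
proof -
  have [simp]: "(\<Sum>x\<in>X. a x * a x) = 1" "\<And>i. i < r \<Longrightarrow> (\<Sum>x\<in>X. u i x * a x) = 0"
    "\<And>i. i < r \<Longrightarrow> (\<Sum>x\<in>X. a x * u i x) = 0"
    using a by (auto simp: unit_orthogonal_def power2_eq_square mult.commute)
  show ?thesis
    unfolding orthonormal_family_def using orthonormal_familyD[OF on]
    by (auto simp: less_Suc_eq)
qed

text \<open>Moving \<open>B\<close> to the other side of the inner product turns \<open>u i\<close>
  into a multiple of \<open>v i\<close>, to which \<open>b\<close> is orthogonal.\<close>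

lemma singular_system_orthogonal_image:
  assumes "singular_system X Y B {..<r} \<sigma> u v" "b \<in> unit_orthogonal Y r v" "i < r"
  shows "(\<Sum>x\<in>X. u i x * (\<Sum>y\<in>Y. B x y * b y)) = 0"
proof -
  have "(\<Sum>x\<in>X. u i x * (\<Sum>y\<in>Y. B x y * b y)) = (\<Sum>x\<in>X. \<Sum>y\<in>Y. u i x * (B x y * b y))"
    by (simp add: sum_distrib_left)
  also have "\<dots> = (\<Sum>y\<in>Y. \<Sum>x\<in>X. u i x * (B x y * b y))"
    by (rule sum.swap)
  also have "\<dots> = (\<Sum>y\<in>Y. b y * (\<Sum>x\<in>X. B x y * u i x))"
    by (simp add: sum_distrib_left mult_ac)
  also have "\<dots> = (\<Sum>y\<in>Y. \<sigma> i * (v i y * b y))"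
    using assms by (intro sum.cong) (auto simp: singular_system_def)
  also have "\<dots> = 0"
    using assms by (simp add: unit_orthogonal_def flip: sum_distrib_left)
  finally show ?thesis .
qed

text \<open>The bilinear form of \<open>B\<close> attains its maximum over pairs of unit vectors
  orthogonal to the vectors already found. With one argument fixed it is linear in the other, so
  \<open>linear_maximizer\<close>, applied on each side, makes the maximizing pair a singular
  pair.\<close>

lemma singular_system_extend:
  assumes fin: "finite X" "finite Y" and sys: "singular_system X Y B {..<r} \<sigma> u v"
    and r: "r < card X" "r < card Y"
  shows "\<exists>s a b. singular_system X Y B {..<Suc r} (\<sigma>(r := s)) (u(r := a)) (v(r := b))"
proof -
  let ?U = "unit_orthogonal X r u" and ?V = "unit_orthogonal Y r v"
  define F where "F p = (\<Sum>x\<in>X. \<Sum>y\<in>Y. B x y * (fst p x * snd p y))"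
    for p :: "('a \<Rightarrow> real) \<times> ('b \<Rightarrow> real)"
  have on: "orthonormal_family X {..<r} u" "orthonormal_family Y {..<r} v"
    using sys by (auto simp: singular_system_def)
  have "compact (?U \<times> ?V)" by (intro compact_Times compact_unit_orthogonal fin)
  moreover have "?U \<times> ?V \<noteq> {}"
    using unit_orthogonal_nonempty[OF fin(1) on(1) r(1)] unit_orthogonal_nonempty[OF fin(2) on(2) r(2)]
    by (simp add: Times_empty)
  moreover have "continuous_on (?U \<times> ?V) F"
    unfolding F_def
    by (intro continuous_intros continuous_on_compose2[OF continuous_on_product_coordinates, of _ fst]
         continuous_on_compose2[OF continuous_on_product_coordinates, of _ snd]) auto
  ultimately obtain a b where ab: "a \<in> ?U" "b \<in> ?V"
    and max: "\<And>h g. h \<in> ?U \<Longrightarrow> g \<in> ?V \<Longrightarrow> F (h, g) \<le> F (a, b)"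
    using continuous_attains_sup[of "?U \<times> ?V" F] by auto
  define s where "s = F (a, b)"
  have F1: "F (h, g) = (\<Sum>x\<in>X. h x * (\<Sum>y\<in>Y. B x y * g y))" for h g
    by (simp add: F_def sum_distrib_left mult_ac)
  have F2: "F (h, g) = (\<Sum>y\<in>Y. g y * (\<Sum>x\<in>X. B x y * h x))" for h g
    unfolding F_def by (subst sum.swap) (simp add: sum_distrib_left mult_ac)
  have 1: "(\<Sum>y\<in>Y. B x y * b y) = s * a x" if "x \<in> X" for x
    by (rule linear_maximizer[OF fin(1) ab(1) singular_system_orthogonal_image[OF sys ab(2)]])
      (use max ab that in \<open>auto simp: s_def simp flip: F1\<close>)
  have 2: "(\<Sum>x\<in>X. B x y * a x) = s * b y" if "y \<in> Y" for y
    by (rule linear_maximizer[OF fin(2) ab(2)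
          singular_system_orthogonal_image[OF singular_system_transpose[OF sys] ab(1)]])
      (use max ab that in \<open>auto simp: s_def simp flip: F2\<close>)
  have "singular_system X Y B {..<Suc r} (\<sigma>(r := s)) (u(r := a)) (v(r := b))"
    using sys orthonormal_family_extend[OF on(1) ab(1)] orthonormal_family_extend[OF on(2) ab(2)] 1 2
    unfolding singular_system_def by (auto simp: less_Suc_eq)
  then show ?thesis by blast
qed

lemma singular_system_complete:
  assumes "finite X" "finite Y" "card X = m" "card Y = m"
    and "singular_system X Y B {..<r} \<sigma> u v" "r \<le> m"
  shows "\<exists>\<sigma>' u' v'. singular_system X Y B {..<m} \<sigma>' u' v' \<and>
    (\<forall>i<r. \<sigma>' i = \<sigma> i \<and> u' i = u i \<and> v' i = v i)"
  using assms(6)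
proof (induction rule: dec_induct)
  case base
  then show ?case using assms by blast
next
  case (step n)
  then obtain \<sigma>' u' v' where *: "singular_system X Y B {..<n} \<sigma>' u' v'"
    "\<forall>i<r. \<sigma>' i = \<sigma> i \<and> u' i = u i \<and> v' i = v i" by blast
  from singular_system_extend[OF assms(1,2) *(1)] step assms obtain s a b where
    "singular_system X Y B {..<Suc n} (\<sigma>'(n := s)) (u'(n := a)) (v'(n := b))" by auto
  with * step show ?case by (intro exI conjI) (assumption, auto)
qed

text \<open>Constant row and column sums make the normalized constant vectors a singular pair, and
  this system of size one is completed to size \<open>m\<close>.\<close>

lemma regular_singular_system:
  fixes B :: "'a \<Rightarrow> 'b \<Rightarrow> real"
  assumes fin: "finite X" "finite Y" and m: "card X = m" "card Y = m" "0 < m"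
    and row: "\<And>x. x \<in> X \<Longrightarrow> (\<Sum>y\<in>Y. B x y) = D" and col: "\<And>y. y \<in> Y \<Longrightarrow> (\<Sum>x\<in>X. B x y) = D"
  obtains \<sigma> u v where "singular_system X Y B {..<m} \<sigma> u v" "\<sigma> 0 = D"
    "\<And>x. u 0 x = 1 / sqrt m" "\<And>y. v 0 y = 1 / sqrt m"
proof -
  have "singular_system X Y B {..<1::nat} (\<lambda>_. D) (\<lambda>_ _. 1 / sqrt m) (\<lambda>_ _. 1 / sqrt m)"
    using m by (auto simp: singular_system_def orthonormal_family_def row col simp flip: sum_divide_distrib)
  from singular_system_complete[OF fin m(1,2) this] m(3) obtain \<sigma> u v where
    "singular_system X Y B {..<m} \<sigma> u v" "\<forall>i<1. \<sigma> i = D \<and> u i = (\<lambda>_. 1 / sqrt m) \<and> v i = (\<lambda>_. 1 / sqrt m)"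
    by auto
  then show ?thesis by (intro that[of \<sigma> u v]) auto
qed

text \<open>Write \<open>\<sigma> i\<close> as the bilinear form of \<open>B\<close> at
  \<open>u i\<close> and \<open>v i\<close>, and bound each product of entries by half the sum of
  their squares. The row sums handle one half and the column sums the other.\<close>

lemma singular_value_le_degree:
  fixes B :: "'a \<Rightarrow> 'b \<Rightarrow> real"
  assumes sys: "singular_system X Y B I \<sigma> u v" and i: "i \<in> I"
    and B: "\<And>x y. 0 \<le> B x y"
    and row: "\<And>x. x \<in> X \<Longrightarrow> (\<Sum>y\<in>Y. B x y) = D" and col: "\<And>y. y \<in> Y \<Longrightarrow> (\<Sum>x\<in>X. B x y) = D"
  shows "\<bar>\<sigma> i\<bar> \<le> D"
proof -
  have nu: "(\<Sum>x\<in>X. u i x * u i x) = 1" and nv: "(\<Sum>y\<in>Y. v i y * v i y) = 1"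
    using sys i by (auto simp: singular_system_def orthonormal_family_def)
  have "\<sigma> i = (\<Sum>x\<in>X. u i x * (\<sigma> i * u i x))"
    using nu by (simp add: mult.left_commute flip: sum_distrib_left)
  also have "\<dots> = (\<Sum>x\<in>X. u i x * (\<Sum>y\<in>Y. B x y * v i y))"
    using sys i by (intro sum.cong) (auto simp: singular_system_def)
  also have "\<dots> = (\<Sum>x\<in>X. \<Sum>y\<in>Y. B x y * (u i x * v i y))"
    by (simp add: sum_distrib_left mult_ac)
  finally have "\<bar>\<sigma> i\<bar> \<le> (\<Sum>x\<in>X. \<Sum>y\<in>Y. \<bar>B x y * (u i x * v i y)\<bar>)"
    using order_trans[OF sum_abs sum_mono[OF sum_abs]] by simp
  also have "\<dots> \<le> (\<Sum>x\<in>X. \<Sum>y\<in>Y. B x y * (u i x * u i x) / 2 + B x y * (v i y * v i y) / 2)"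
  proof (intro sum_mono)
    fix x y
    have "2 * \<bar>u i x * v i y\<bar> \<le> u i x * u i x + v i y * v i y"
      using sum_squares_bound[of "\<bar>u i x\<bar>" "\<bar>v i y\<bar>"] by (simp add: abs_mult power2_eq_square)
    from mult_left_mono[OF this B[of x y]]
    show "\<bar>B x y * (u i x * v i y)\<bar> \<le> B x y * (u i x * u i x) / 2 + B x y * (v i y * v i y) / 2"
      using B[of x y] by (simp add: abs_mult algebra_simps)
  qed
  also have "\<dots> = (\<Sum>x\<in>X. \<Sum>y\<in>Y. B x y * (u i x * u i x)) / 2 + (\<Sum>y\<in>Y. \<Sum>x\<in>X. B x y * (v i y * v i y)) / 2"
    by (simp add: sum.distrib sum.swap[of "\<lambda>y x. B x y * (v i y * v i y)"] flip: sum_divide_distrib)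
  also have "\<dots> = (\<Sum>x\<in>X. D * (u i x * u i x)) / 2 + (\<Sum>y\<in>Y. D * (v i y * v i y)) / 2"
    by (intro arg_cong2[of _ _ _ _ "(+)"] arg_cong2[of _ _ _ _ "(/)"] sum.cong)
      (auto simp: row col simp flip: sum_distrib_right)
  also have "\<dots> = D" by (simp add: nu nv flip: sum_distrib_left)
  finally show ?thesis .
qed

subsection \<open>Tensor powers\<close>

lemma tuples_0: "tuples 0 X = {[]}"
  by (auto simp: tuples_def)

lemma sum_tuples_Suc:
  assumes "finite X"
  shows "(\<Sum>xs\<in>tuples (Suc k) X. f xs) = (\<Sum>x\<in>X. \<Sum>xs\<in>tuples k X. f (x # xs))"
proof -
  have "tuples (Suc k) X = (\<lambda>(x, xs). x # xs) ` (X \<times> tuples k X)"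
    by (auto simp: tuples_def length_Suc_conv image_iff)
  moreover have "inj_on (\<lambda>(x, xs). x # xs) (X \<times> tuples k X)"
    by (auto simp: inj_on_def)
  ultimately have "(\<Sum>xs\<in>tuples (Suc k) X. f xs) = (\<Sum>(x, xs)\<in>X \<times> tuples k X. f (x # xs))"
    by (simp add: sum.reindex case_prod_unfold)
  then show ?thesis by (simp add: sum.cartesian_product)
qed

lemma finite_tuples: "finite X \<Longrightarrow> finite (tuples k X)"
  using finite_lists_length_eq[of X k] by (simp add: tuples_def conj_commute)

lemma card_tuples: "finite X \<Longrightarrow> card (tuples k X) = card X ^ k"
  using card_lists_length_eq[of X k] by (simp add: tuples_def conj_commute)

text \<open>The default value 1 is the empty product. Below, index tuple and argument have the same
  length.\<close>

fun tensor :: "('i \<Rightarrow> 'a \<Rightarrow> real) \<Rightarrow> 'i list \<Rightarrow> 'a list \<Rightarrow> real" where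
  "tensor u (i # ix) (x # xs) = u i x * tensor u ix xs"
| "tensor u _ _ = 1"

text \<open>The inner product of two tensors is the product of the coordinatewise inner
  products.\<close>

lemma orthonormal_family_tensor:
  assumes fin: "finite X" and on: "orthonormal_family X I u"
  shows "orthonormal_family (tuples k X) (tuples k I) (tensor u)"
proof (induction k)
  case 0
  then show ?case by (simp add: orthonormal_family_def tuples_0)
next
  case (Suc k)
  show ?case
    unfolding orthonormal_family_def
  proof (intro ballI)
    fix ix js assume "ix \<in> tuples (Suc k) I" "js \<in> tuples (Suc k) I"
    then obtain i ix' j js' where *: "ix = i # ix'" "js = j # js'" "i \<in> I" "j \<in> I"
      "ix' \<in> tuples k I" "js' \<in> tuples k I"
      by (auto simp: tuples_def length_Suc_conv)
    have "(\<Sum>xs\<in>tuples (Suc k) X. tensor u ix xs * tensor u js xs) =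
        (\<Sum>x\<in>X. \<Sum>xs\<in>tuples k X. (u i x * u j x) * (tensor u ix' xs * tensor u js' xs))"
      by (simp add: sum_tuples_Suc[OF fin] * mult_ac)
    also have "\<dots> = (\<Sum>x\<in>X. u i x * u j x) * (\<Sum>xs\<in>tuples k X. tensor u ix' xs * tensor u js' xs)"
      by (simp add: sum_product)
    also have "\<dots> = (if ix = js then 1 else 0)"
      using orthonormal_familyD[OF on *(3,4)] orthonormal_familyD[OF Suc *(5,6)] by (simp add: *)
    finally show "(\<Sum>xs\<in>tuples (Suc k) X. tensor u ix xs * tensor u js xs) = (if ix = js then 1 else 0)" .
  qed
qed

text \<open>
  \<open>threshold B t xs ys\<close> is the adjacency indicator of \<open>BGP\<^bsub>k,t\<^esub>\<close>: an edge at the first coordinate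
  lowers the required number of edges by one. Once \<open>t = 0\<close>, both branches agree.
\<close>

fun threshold :: "('a \<Rightarrow> 'b \<Rightarrow> real) \<Rightarrow> nat \<Rightarrow> 'a list \<Rightarrow> 'b list \<Rightarrow> real" where
  "threshold B t (x # xs) (y # ys) =
     B x y * threshold B (t - 1) xs ys + (1 - B x y) * threshold B t xs ys"
| "threshold B t _ _ = (if t = 0 then 1 else 0)"

text \<open>The recursion of \<open>threshold\<close> with values in place of matrix entries. It
  computes the sum of the coefficients of \<open>z^a\<close>, \<open>a \<ge> t\<close>, in the
  product of the \<open>c i + b i z\<close>. At \<open>t = 0\<close> truncated subtraction makes
  every step a factor \<open>b i + c i\<close>, the full coefficient sum.\<close>

fun tail_coeff :: "('i \<Rightarrow> real) \<Rightarrow> ('i \<Rightarrow> real) \<Rightarrow> nat \<Rightarrow> 'i list \<Rightarrow> real" where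
  "tail_coeff b c t (i # ix) = b i * tail_coeff b c (t - 1) ix + c i * tail_coeff b c t ix"
| "tail_coeff b c t [] = (if t = 0 then 1 else 0)"

lemma threshold_eq:
  assumes "length xs = length ys"
  shows "threshold (\<lambda>x y. if P x y then 1 else 0) t xs ys =
    (if t \<le> card {i. i < length xs \<and> P (xs ! i) (ys ! i)} then 1 else 0)"
  using assms
proof (induction xs ys arbitrary: t rule: list_induct2)
  case (Cons x xs y ys)
  let ?S = "{i. i < length xs \<and> P (xs ! i) (ys ! i)}"
  have "{i. i < length (x # xs) \<and> P ((x # xs) ! i) ((y # ys) ! i)} = (if P x y then {0} else {}) \<union> Suc ` ?S"
  proof (subst set_eq_iff, rule allI)
    fix j
    show "j \<in> {i. i < length (x # xs) \<and> P ((x # xs) ! i) ((y # ys) ! i)} \<longleftrightarrow>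
        j \<in> (if P x y then {0} else {}) \<union> Suc ` ?S"
      by (cases j) auto
  qed
  moreover have "card ((if P x y then {0} else {}) \<union> Suc ` ?S) = (if P x y then 1 else 0) + card ?S"
    by (subst card_Un_disjoint) (auto simp: card_image)
  ultimately show ?case using Cons by auto
qed simp

text \<open>Splitting off the first coordinate writes the threshold matrix as \<open>B\<close>
  tensor the matrix for \<open>t - 1\<close>, plus the complement of \<open>B\<close> tensor the
  matrix for \<open>t\<close>. Both summands act coordinatewise on tensors.\<close>

lemma threshold_tensor:
  fixes v :: "'i \<Rightarrow> 'b \<Rightarrow> real"
  assumes fin: "finite Y"
    and b: "\<And>i x. i \<in> I \<Longrightarrow> x \<in> X \<Longrightarrow> (\<Sum>y\<in>Y. B x y * v i y) = b i * u i x"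
    and c: "\<And>i x. i \<in> I \<Longrightarrow> x \<in> X \<Longrightarrow> (\<Sum>y\<in>Y. (1 - B x y) * v i y) = c i * u i x"
    and "ix \<in> tuples k I" "xs \<in> tuples k X"
  shows "(\<Sum>ys\<in>tuples k Y. threshold B t xs ys * tensor v ix ys) = tail_coeff b c t ix * tensor u ix xs"
  using assms(4,5)
proof (induction k arbitrary: t ix xs)
  case 0
  then show ?case by (simp add: tuples_0)
next
  case (Suc k)
  then obtain i ix' x xs' where *: "ix = i # ix'" "xs = x # xs'" "i \<in> I" "x \<in> X"
    "ix' \<in> tuples k I" "xs' \<in> tuples k X"
    by (auto simp: tuples_def length_Suc_conv)
  have "(\<Sum>ys\<in>tuples (Suc k) Y. threshold B t xs ys * tensor v ix ys) =
     (\<Sum>y\<in>Y. \<Sum>ys\<in>tuples k Y. (B x y * v i y) * (threshold B (t - 1) xs' ys * tensor v ix' ys)) +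
     (\<Sum>y\<in>Y. \<Sum>ys\<in>tuples k Y. ((1 - B x y) * v i y) * (threshold B t xs' ys * tensor v ix' ys))"
    by (simp add: sum_tuples_Suc[OF fin] * algebra_simps flip: sum.distrib)
  also have "\<dots> = (b i * u i x) * (tail_coeff b c (t - 1) ix' * tensor u ix' xs')
      + (c i * u i x) * (tail_coeff b c t ix' * tensor u ix' xs')"
    by (simp add: Suc.IH * b c flip: sum_product)
  also have "\<dots> = tail_coeff b c t ix * tensor u ix xs"
    by (simp add: * algebra_simps)
  finally show ?case .
qed

lemma threshold_transpose: "threshold (\<lambda>y x. B x y) t ys xs = threshold B t xs ys"
proof (induction xs arbitrary: t ys)
  case (Cons x xs)
  then show ?case by (cases ys) auto
next
  case Nil
  then show ?case by (cases ys) auto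
qed

lemma singular_system_threshold:
  fixes B :: "'a \<Rightarrow> 'b \<Rightarrow> real"
  assumes fin: "finite X" "finite Y" and sys: "singular_system X Y B I b u v"
    and comp: "singular_system X Y (\<lambda>x y. 1 - B x y) I c u v"
  shows "singular_system (tuples k X) (tuples k Y) (threshold B t) (tuples k I)
    (tail_coeff b c t) (tensor u) (tensor v)"
proof -
  have row: "(\<Sum>ys\<in>tuples k Y. threshold B t xs ys * tensor v ix ys) = tail_coeff b c t ix * tensor u ix xs"
    if "ix \<in> tuples k I" "xs \<in> tuples k X" for ix xs
    using sys comp by (intro threshold_tensor[OF fin(2) _ _ that]) (auto simp: singular_system_def)
  have col: "(\<Sum>xs\<in>tuples k X. threshold B t xs ys * tensor u ix xs) =
      tail_coeff b c t ix * tensor v ix ys"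
    if "ix \<in> tuples k I" "ys \<in> tuples k Y" for ix ys
    \<comment> \<open>The column identity is the row identity of the transposed matrix.\<close>
    unfolding threshold_transpose[of B, symmetric]
    using sys comp by (intro threshold_tensor[OF fin(1) _ _ that]) (auto simp: singular_system_def)
  show ?thesis
    using sys row col orthonormal_family_tensor[OF fin(1)] orthonormal_family_tensor[OF fin(2)]
    unfolding singular_system_def by blast
qed

text \<open>Every vector of index other than 0 is orthogonal to the constant one, so its entries sum
  to zero and the all-ones matrix kills it. At index 0 the all-ones matrix contributes
  \<open>m\<close>.\<close>

lemma singular_system_complement:
  fixes B :: "'a \<Rightarrow> 'b \<Rightarrow> real"
  assumes fin: "finite X" "finite Y" and m: "card X = m" "card Y = m" "0 < m"
    and sys: "singular_system X Y B {..<m} \<sigma> u v"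
    and u0: "\<And>x. u 0 x = 1 / sqrt m" and v0: "\<And>y. v 0 y = 1 / sqrt m"
  shows "singular_system X Y (\<lambda>x y. 1 - B x y) {..<m} (\<lambda>i. if i = 0 then m - \<sigma> 0 else - \<sigma> i) u v"
proof -
  have on: "orthonormal_family X {..<m} u" "orthonormal_family Y {..<m} v"
    using sys by (auto simp: singular_system_def)
  have su: "(\<Sum>x\<in>X. u i x) = (if i = 0 then sqrt m else 0)" if "i < m" for i
    using orthonormal_familyD[OF on(1), of i 0] that m u0
    by (auto simp: real_div_sqrt simp flip: sum_divide_distrib)
  have sv: "(\<Sum>y\<in>Y. v i y) = (if i = 0 then sqrt m else 0)" if "i < m" for i
    using orthonormal_familyD[OF on(2), of i 0] that m v0
    by (auto simp: real_div_sqrt simp flip: sum_divide_distrib)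
  \<comment> \<open>The entry sum \<open>sqrt m\<close> of the constant vector is \<open>m\<close>
    times its entry, so the all-ones matrix has value \<open>m\<close> there.\<close>
  have r: "sqrt m = real m * (1 / sqrt m)" using m by (simp add: real_div_sqrt)
  show ?thesis
    using sys su sv r u0 v0
    by (auto simp: singular_system_def left_diff_distrib diff_divide_distrib sum_subtractf)
qed

section \<open>Singular values of threshold powers as polynomial coefficients\<close>

lemma degree_prod_list_linear: "degree (\<Prod>i\<leftarrow>ix. [:c i, b i:]) \<le> length ix"
proof (induction ix)
  case (Cons i ix)
  have "degree ([:c i, b i:] * (\<Prod>i\<leftarrow>ix. [:c i, b i:])) \<le>
      degree [:c i, b i:] + degree (\<Prod>i\<leftarrow>ix. [:c i, b i:])"
    by (rule degree_mult_le)
  with Cons show ?case by (simp del: mult_pCons_left split: if_splits)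
qed simp

text \<open>In the product of \<open>c i + b i z\<close> with a polynomial, the part with factor
  \<open>z\<close> shifts coefficients by one, so its tail from \<open>t\<close> is the original
  tail from \<open>t - 1\<close>.\<close>

lemma tail_coeff_eq_sum:
  "tail_coeff b c t ix = (\<Sum>a=t..length ix. coeff (\<Prod>i\<leftarrow>ix. [:c i, b i:]) a)"
proof (induction ix arbitrary: t)
  case (Cons i ix)
  let ?p = "\<Prod>i\<leftarrow>ix. [:c i, b i:]" and ?l = "length ix"
  have deg: "coeff ?p (Suc ?l) = 0"
    using degree_prod_list_linear[of c b ix] by (intro coeff_eq_0) simp
  \<comment> \<open>For \<open>t = 0\<close> the truncated \<open>t - 1\<close> is still right: the
    extra constant coefficient on the left is zero.\<close>
  have shift: "(\<Sum>a=t..Suc ?l. coeff (pCons 0 ?p) a) = (\<Sum>a=t - 1..?l. coeff ?p a)"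
  proof (cases t)
    case 0
    then show ?thesis
      by (simp add: sum.atLeast_Suc_atMost sum.shift_bounds_cl_Suc_ivl del: sum.cl_ivl_Suc)
  qed (simp add: sum.shift_bounds_cl_Suc_ivl del: sum.cl_ivl_Suc)
  have "(\<Sum>a=t..Suc ?l. coeff ([:c i, b i:] * ?p) a) =
      c i * (\<Sum>a=t..Suc ?l. coeff ?p a) + b i * (\<Sum>a=t..Suc ?l. coeff (pCons 0 ?p) a)"
    unfolding sum_distrib_left sum.distrib[symmetric]
    by (intro sum.cong refl) (simp add: coeff_pCons split: nat.splits)
  also have "(\<Sum>a=t..Suc ?l. coeff ?p a) = (\<Sum>a=t..?l. coeff ?p a)"
    by (cases "t \<le> Suc ?l") (auto simp: deg)
  finally show ?case by (simp add: Cons.IH shift del: sum.cl_ivl_Suc)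
qed simp

text \<open>The factor at \<open>i\<close> is \<open>b i (z - 1)\<close>. Multiplying by
  \<open>z - 1\<close> turns the tail sum from \<open>t\<close> into the difference of the tails
  from \<open>t - 1\<close> and \<open>t\<close>, which is one coefficient.\<close>

lemma tail_coeff_nontrivial:
  assumes i: "i \<in> set ix" "c i = - b i" and t: "1 \<le> t"
  shows "tail_coeff b c t ix = b i * coeff (\<Prod>j\<leftarrow>remove1 i ix. [:c j, b j:]) (t - 1)"
proof -
  let ?r = "remove1 i ix" and ?p = "\<lambda>ix. \<Prod>j\<leftarrow>ix. [:c j, b j:]"
  \<comment> \<open>The product depends only on the multiset of indices, so \<open>i\<close> may be
    moved to the front, where the recursion exposes its factor.\<close>
  have mset: "mset ix = mset (i # ?r)" using i by simp
  then have "prod_mset (image_mset (\<lambda>j. [:c j, b j:]) (mset ix)) =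
      prod_mset (image_mset (\<lambda>j. [:c j, b j:]) (mset (i # ?r)))" by simp
  then have "?p ix = ?p (i # ?r)" by (simp only: prod_mset_prod_list flip: mset_map)
  moreover have "length ix = length (i # ?r)" using mset by (rule mset_eq_length)
  ultimately have "tail_coeff b c t ix = tail_coeff b c t (i # ?r)"
    by (simp only: tail_coeff_eq_sum)
  also have "\<dots> = b i * (tail_coeff b c (t - 1) ?r - tail_coeff b c t ?r)"
    using i by (simp add: algebra_simps)
  also have "tail_coeff b c (t - 1) ?r - tail_coeff b c t ?r = coeff (?p ?r) (t - 1)"
  proof (cases "t - 1 \<le> length ?r")
    case True
    with t show ?thesis by (simp add: tail_coeff_eq_sum sum.atLeast_Suc_atMost)
  next
    case False
    with False have "coeff (?p ?r) (t - 1) = 0"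
      using degree_prod_list_linear[of c b ?r] by (intro coeff_eq_0) simp
    with False show ?thesis by (simp add: tail_coeff_eq_sum)
  qed
  finally show ?thesis .
qed

text \<open>Each factor is dominated coefficientwise by \<open>q + p z\<close>, and the triangle
  inequality carries this domination through products.\<close>

lemma coeff_prod_list_le:
  fixes b c :: "'i \<Rightarrow> real"
  assumes "\<And>i. i \<in> set ix \<Longrightarrow> \<bar>b i\<bar> \<le> p" "\<And>i. i \<in> set ix \<Longrightarrow> \<bar>c i\<bar> \<le> q"
  shows "\<bar>coeff (\<Prod>i\<leftarrow>ix. [:c i, b i:]) a\<bar> \<le> coeff ([:q, p:] ^ length ix) a"
  using assms
proof (induction ix arbitrary: a)
  case (Cons i ix)
  let ?P = "\<Prod>i\<leftarrow>ix. [:c i, b i:]" and ?Q = "[:q, p:] ^ length ix"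
  have IH: "\<bar>coeff ?P a\<bar> \<le> coeff ?Q a" for a
    using Cons by simp
  \<comment> \<open>Nonnegativity of \<open>p\<close> and \<open>q\<close> is read off from the
    bounds at the head \<open>i\<close>.\<close>
  have "0 \<le> \<bar>b i\<bar>" by simp
  also have p: "\<bar>b i\<bar> \<le> p" using Cons.prems by simp
  finally have "0 \<le> p" .
  have "0 \<le> \<bar>c i\<bar>" by simp
  also have q: "\<bar>c i\<bar> \<le> q" using Cons.prems by simp
  finally have "0 \<le> q" .
  have bnd: "\<bar>b i * coeff ?P a\<bar> \<le> p * coeff ?Q a" "\<bar>c i * coeff ?P a\<bar> \<le> q * coeff ?Q a" for a
    using IH[of a] p q \<open>0 \<le> p\<close> \<open>0 \<le> q\<close> by (auto simp: abs_mult intro!: mult_mono)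
  show ?case
    using bnd(2)[of a] bnd(1)[of "a - 1"]
    by (cases a) (auto intro: order_trans[OF abs_triangle_ineq])
qed auto

subsection \<open>Spectra of bipartite graphs\<close>

lemma vertex_list:
  assumes "finite V"
  shows "distinct (vertex_list V)" "set (vertex_list V) = V" "length (vertex_list V) = card V"
proof -
  have "\<exists>vs. distinct vs \<and> set vs = V"
    using finite_distinct_list[OF assms] by blast
  then have *: "distinct (vertex_list V) \<and> set (vertex_list V) = V"
    unfolding vertex_list_def by (rule someI_ex)
  then show "distinct (vertex_list V)" "set (vertex_list V) = V" by auto
  from * show "length (vertex_list V) = card V" by (metis distinct_card)
qed

lemma sum_nth_distinct:
  assumes "distinct vs"
  shows "(\<Sum>j = 0..<length vs. f (vs ! j)) = (\<Sum>v\<in>set vs. f v)"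
  using sum.reindex_bij_betw[OF bij_betw_nth[OF assms refl refl]] by (simp add: atLeast0LessThan)

text \<open>As many orthonormal eigenvectors as vertices form a basis. With them as columns,
  \<open>P\<close> has its transpose \<open>Q\<close> as inverse and conjugates the adjacency matrix
  to a diagonal one, whose characteristic polynomial shows the roots with multiplicity.\<close>

lemma proots_adjacency_matrix:
  assumes fin: "finite V" "finite I" "card I = card V" and on: "orthonormal_family V I \<phi>"
    and ev: "\<And>i v. i \<in> I \<Longrightarrow> v \<in> V \<Longrightarrow> (\<Sum>w\<in>V. (if {v, w} \<in> E then 1 else 0) * \<phi> i w) = \<mu> i * \<phi> i v"
  shows "proots (char_poly (adjacency_matrix V E)) = image_mset \<mu> (mset_set I)"
proof -
  define N where "N = card V"
  define vs where "vs = vertex_list V"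
  have vs: "distinct vs" "set vs = V" "length vs = N"
    using vertex_list[OF fin(1)] by (auto simp: vs_def N_def)
  obtain ix where ix: "distinct ix" "set ix = I" using finite_distinct_list[OF fin(2)] by blast
  then have lix: "length ix = N" using fin(3) by (metis N_def distinct_card)
  have vsV: "vs ! a \<in> V" if "a < N" for a using vs that nth_mem by blast
  have ixI: "ix ! a \<in> I" if "a < N" for a using ix lix that nth_mem by blast
  define A where "A = adjacency_matrix V E"
  have A: "A = mat N N (\<lambda>(a, c). if {vs ! a, vs ! c} \<in> E then 1 else 0)"
    by (simp add: A_def adjacency_matrix_def N_def vs_def)
  define P where "P = mat N N (\<lambda>(a, c). \<phi> (ix ! c) (vs ! a))"
  define Q where "Q = mat N N (\<lambda>(a, c). \<phi> (ix ! a) (vs ! c))"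
  define D where "D = mat N N (\<lambda>(a, c). if a = c then \<mu> (ix ! a) else 0)"
  have carr: "A \<in> carrier_mat N N" "P \<in> carrier_mat N N" "Q \<in> carrier_mat N N" "D \<in> carrier_mat N N"
    by (simp_all add: A P_def Q_def D_def)
  have QP: "Q * P = 1\<^sub>m N"
  proof (rule eq_matI)
    fix a c assume "a < dim_row (1\<^sub>m N)" "c < dim_col (1\<^sub>m N)"
    then have ac: "a < N" "c < N" by auto
    have "(Q * P) $$ (a, c) = (\<Sum>j = 0..<length vs. \<phi> (ix ! a) (vs ! j) * \<phi> (ix ! c) (vs ! j))"
      using ac by (simp add: Q_def P_def scalar_prod_def vs)
    also have "\<dots> = (if ix ! a = ix ! c then 1 else 0)"
      unfolding sum_nth_distinct[OF vs(1), of "\<lambda>v. \<phi> (ix ! a) v * \<phi> (ix ! c) v"]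
      using orthonormal_familyD[OF on] ixI ac vs by simp
    also have "\<dots> = 1\<^sub>m N $$ (a, c)"
      using ac ix lix by (simp add: nth_eq_iff_index_eq)
    finally show "(Q * P) $$ (a, c) = 1\<^sub>m N $$ (a, c)" .
  qed (simp_all add: P_def Q_def)
  then have PQ: "P * Q = 1\<^sub>m N"
    by (rule mat_mult_left_right_inverse[OF carr(3,2)])
  have AP: "A * P = P * D"
  proof (rule eq_matI)
    fix a c assume "a < dim_row (P * D)" "c < dim_col (P * D)"
    then have ac: "a < N" "c < N" by (auto simp: P_def D_def)
    have "(A * P) $$ (a, c) =
        (\<Sum>j = 0..<length vs. (if {vs ! a, vs ! j} \<in> E then 1 else 0) * \<phi> (ix ! c) (vs ! j))"
      using ac by (simp add: A P_def scalar_prod_def vs)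
    also have "\<dots> = \<mu> (ix ! c) * \<phi> (ix ! c) (vs ! a)"
      unfolding sum_nth_distinct[OF vs(1), of "\<lambda>w. (if {vs ! a, w} \<in> E then 1 else 0) * \<phi> (ix ! c) w"]
      using ev[OF ixI vsV] ac vs by simp
    also have "\<dots> = (\<Sum>j = 0..<N. \<phi> (ix ! j) (vs ! a) * (if j = c then \<mu> (ix ! j) else 0))"
      using ac by (simp add: if_distrib[of "(*) _"] cong: if_cong)
    also have "\<dots> = (P * D) $$ (a, c)"
      using ac by (simp add: P_def D_def scalar_prod_def)
    finally show "(A * P) $$ (a, c) = (P * D) $$ (a, c)" .
  qed (simp_all add: A P_def D_def)
  have "A = A * (P * Q)" using carr by (simp add: PQ)
  also have "\<dots> = P * D * Q"
    using assoc_mult_mat[OF carr(1-3)] by (simp add: AP)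
  finally have "similar_mat A D"
    using carr by (intro similar_matI[OF _ PQ QP]) auto
  then have "char_poly A = char_poly D" by (rule char_poly_similar)
  also have "\<dots> = (\<Prod>a\<leftarrow>diag_mat D. [:- a, 1:])"
    by (rule char_poly_upper_triangular[OF carr(4)]) (auto simp: D_def upper_triangular_def)
  also have "diag_mat D = map \<mu> ix"
    by (rule nth_equalityI) (auto simp: diag_mat_def D_def lix)
  finally have "char_poly A = (\<Prod>p\<leftarrow>map (\<lambda>i. [:- \<mu> i, 1:]) ix. p)" by (simp add: o_def)
  also have "proots \<dots> = (\<Sum>p\<leftarrow>map (\<lambda>i. [:- \<mu> i, 1:]) ix. proots p)"
    by (rule proots_prod_list) auto
  also have "\<dots> = mset (map \<mu> ix)"
    by (induction ix) auto
  also have "\<dots> = image_mset \<mu> (mset_set I)"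
    using ix by (metis mset_map mset_set_set)
  finally show ?thesis by (simp add: A_def)
qed

text \<open>Each singular pair gives two unit eigenvectors, \<open>u i\<close> on \<open>X\<close>
  joined with plus or minus \<open>v i\<close> on \<open>Y\<close>, divided by
  \<open>sqrt 2\<close>. Their eigenvalues are plus and minus \<open>\<mu> i\<close>.\<close>

lemma proots_adjacency_bipartite:
  fixes E :: "'a set set"
  assumes bip: "bipartite_graph X Y E" and I: "finite I" "card I = card X" "card I = card Y"
    and sys: "singular_system X Y (\<lambda>x y. if {x, y} \<in> E then 1 else 0) I \<mu> u v"
  shows "proots (char_poly (adjacency_matrix (X \<union> Y) E)) =
    image_mset \<mu> (mset_set I) + image_mset (\<lambda>i. - \<mu> i) (mset_set I)"
proof -
  have fin: "finite X" "finite Y" and dis: "X \<inter> Y = {}"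
    and E: "E \<subseteq> {{x, y} | x y. x \<in> X \<and> y \<in> Y}"
    using bip by (auto simp: bipartite_graph_def)
  have noE: "{x, x'} \<notin> E" if "x \<in> X \<and> x' \<in> X \<or> x \<in> Y \<and> x' \<in> Y" for x x'
    using E dis that by (auto simp: doubleton_eq_iff dest!: subsetD)
  define \<epsilon> :: "bool \<Rightarrow> real" where "\<epsilon> s = (if s then 1 else - 1)" for s
  define \<phi> where "\<phi> = (\<lambda>(i, s) w. (if w \<in> X then u i w else \<epsilon> s * v i w) / sqrt 2)"
  have \<phi>: "\<And>i s x. x \<in> X \<Longrightarrow> \<phi> (i, s) x = u i x / sqrt 2"
    "\<And>i s y. y \<in> Y \<Longrightarrow> \<phi> (i, s) y = \<epsilon> s * v i y / sqrt 2"
    using dis by (auto simp: \<phi>_def)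
  have split: "(\<Sum>w\<in>X \<union> Y. f w) = (\<Sum>x\<in>X. f x) + (\<Sum>y\<in>Y. f y)" for f :: "'a \<Rightarrow> real"
    using fin dis by (rule sum.union_disjoint)
  have "orthonormal_family (X \<union> Y) (I \<times> UNIV) \<phi>"
    unfolding orthonormal_family_def
  proof (intro ballI)
    fix p q assume "p \<in> I \<times> (UNIV :: bool set)" "q \<in> I \<times> (UNIV :: bool set)"
    then obtain i s j r where *: "p = (i, s)" "q = (j, r)" "i \<in> I" "j \<in> I" by auto
    \<comment> \<open>For \<open>i = j\<close> the two halves add up to 1 when the signs agree and
      cancel when they differ.\<close>
    have "(\<Sum>w\<in>X \<union> Y. \<phi> p w * \<phi> q w) =
        (\<Sum>x\<in>X. u i x * u j x) / 2 + \<epsilon> s * \<epsilon> r * (\<Sum>y\<in>Y. v i y * v j y) / 2"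
      unfolding split * sum_distrib_left sum_divide_distrib
      by (intro arg_cong2[of _ _ _ _ "(+)"] sum.cong) (auto simp: \<phi>)
    then show "(\<Sum>w\<in>X \<union> Y. \<phi> p w * \<phi> q w) = (if p = q then 1 else 0)"
      using sys * by (auto simp: singular_system_def orthonormal_family_def \<epsilon>_def)
  qed
  moreover have "(\<Sum>w\<in>X \<union> Y. (if {z, w} \<in> E then 1 else 0) * \<phi> p w) = (\<epsilon> (snd p) * \<mu> (fst p)) * \<phi> p z"
    if p: "p \<in> I \<times> UNIV" and z: "z \<in> X \<union> Y" for p z
  proof -
    obtain i s where *: "p = (i, s)" "i \<in> I" using p by auto
    from z consider "z \<in> X" | "z \<in> Y" by auto
    then show ?thesis
    proof cases
      case 1
      then have "(\<Sum>w\<in>X \<union> Y. (if {z, w} \<in> E then 1 else 0) * \<phi> p w) =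
          (\<Sum>y\<in>Y. \<epsilon> s / sqrt 2 * ((if {z, y} \<in> E then 1 else 0) * v i y))"
        unfolding split using noE by (simp add: \<phi> *) (intro sum.cong, auto simp: \<phi>)
      also have "\<dots> = \<epsilon> s / sqrt 2 * (\<mu> i * u i z)"
        using sys * 1 by (subst sum_distrib_left[symmetric]) (auto simp: singular_system_def)
      finally show ?thesis using 1 by (simp add: \<phi> *)
    next
      case 2
      have sw: "{z, x} = {x, z}" for x by auto
      from 2 have "(\<Sum>w\<in>X \<union> Y. (if {z, w} \<in> E then 1 else 0) * \<phi> p w) =
          (\<Sum>x\<in>X. 1 / sqrt 2 * ((if {x, z} \<in> E then 1 else 0) * u i x))"
        unfolding split using noE by (simp add: \<phi> *) (intro sum.cong, auto simp: \<phi> sw)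
      also have "\<dots> = 1 / sqrt 2 * (\<mu> i * v i z)"
        using sys * 2 by (subst sum_distrib_left[symmetric]) (auto simp: singular_system_def)
      also have "\<dots> = (\<epsilon> s * \<mu> i) * \<phi> p z" using 2 by (simp add: \<phi> * \<epsilon>_def)
      finally show ?thesis by (simp add: *)
    qed
  qed
  moreover have "card (I \<times> (UNIV :: bool set)) = card (X \<union> Y)"
    using I fin dis by (simp add: card_cartesian_product card_Un_disjoint)
  ultimately have "proots (char_poly (adjacency_matrix (X \<union> Y) E)) =
      image_mset (\<lambda>p. \<epsilon> (snd p) * \<mu> (fst p)) (mset_set (I \<times> UNIV))"
    using fin I by (intro proots_adjacency_matrix) auto
  also have "I \<times> (UNIV :: bool set) = (\<lambda>i. (i, True)) ` I \<union> (\<lambda>i. (i, False)) ` I"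
    by (auto simp: image_iff)
  also have "mset_set \<dots> = image_mset (\<lambda>i. (i, True)) (mset_set I) + image_mset (\<lambda>i. (i, False)) (mset_set I)"
    using I by (subst mset_set_Union) (auto simp: image_mset_mset_set inj_on_def)
  finally show ?thesis by (simp add: image_mset.compositionality o_def \<epsilon>_def)
qed

text \<open>The spectrum consists of pairs of opposite numbers, so the two pairs of largest absolute
  value occupy the two outermost places at both ends.\<close>

lemma sorted_spectrum_symmetric:
  fixes \<mu> :: "'i \<Rightarrow> real"
  assumes fin: "finite I" and i: "i0 \<in> I" "i1 \<in> I" "i0 \<noteq> i1"
    and top: "\<bar>\<mu> i1\<bar> \<le> \<bar>\<mu> i0\<bar>" and snd: "\<And>i. i \<in> I \<Longrightarrow> i \<noteq> i0 \<Longrightarrow> \<bar>\<mu> i\<bar> \<le> \<bar>\<mu> i1\<bar>"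
  obtains S where "sorted_list_of_multiset (image_mset \<mu> (mset_set I) + image_mset (\<lambda>i. - \<mu> i) (mset_set I)) =
    [- \<bar>\<mu> i0\<bar>, - \<bar>\<mu> i1\<bar>] @ S @ [\<bar>\<mu> i1\<bar>, \<bar>\<mu> i0\<bar>]"
proof -
  define J where "J = I - {i0, i1}"
  define R where "R = image_mset \<mu> (mset_set J) + image_mset (\<lambda>i. - \<mu> i) (mset_set J)"
  define S where "S = sorted_list_of_multiset R"
  have J: "finite J" "I = insert i0 (insert i1 J)" "i0 \<notin> insert i1 J" "i1 \<notin> J"
    using fin i by (auto simp: J_def)
  have pm: "{#a, - a#} = {#\<bar>a\<bar>, - \<bar>a\<bar>#}" for a :: real by (simp add: abs_if add_mset_commute)
  have "image_mset \<mu> (mset_set I) + image_mset (\<lambda>i. - \<mu> i) (mset_set I) =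
      {#\<mu> i0, - \<mu> i0#} + {#\<mu> i1, - \<mu> i1#} + R"
    using J by (simp add: R_def)
  also have "\<dots> = mset ([- \<bar>\<mu> i0\<bar>, - \<bar>\<mu> i1\<bar>] @ S @ [\<bar>\<mu> i1\<bar>, \<bar>\<mu> i0\<bar>])"
    by (simp add: S_def pm[of "\<mu> i0"] pm[of "\<mu> i1"])
  finally have *: "image_mset \<mu> (mset_set I) + image_mset (\<lambda>i. - \<mu> i) (mset_set I) = \<dots>" .
  have "\<bar>x\<bar> \<le> \<bar>\<mu> i1\<bar>" if "x \<in> set S" for x
  proof -
    obtain j where "j \<in> J" "x = \<mu> j \<or> x = - \<mu> j"
      using \<open>x \<in> set S\<close> J(1) by (auto simp: S_def R_def)
    then show ?thesis using snd[of j] by (auto simp: J_def)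
  qed
  then have "- \<bar>\<mu> i1\<bar> \<le> x" "x \<le> \<bar>\<mu> i1\<bar>" if "x \<in> set S" for x
    using that by (auto simp: abs_le_iff minus_le_iff)
  then have "sorted ([- \<bar>\<mu> i0\<bar>, - \<bar>\<mu> i1\<bar>] @ S @ [\<bar>\<mu> i1\<bar>, \<bar>\<mu> i0\<bar>])"
    using top by (force simp: sorted_append S_def)
  then show ?thesis
    by (intro that[of S]) (simp only: * sorted_list_of_multiset_mset sorted_sort_id)
qed

lemma third_abs_eigenvalue_bipartite:
  fixes E :: "'a set set"
  assumes bip: "bipartite_graph X Y E" and I: "finite I" "card I = card X" "card I = card Y"
    and sys: "singular_system X Y (\<lambda>x y. if {x, y} \<in> E then 1 else 0) I \<mu> u v"
    and i: "i0 \<in> I" "i1 \<in> I" "i0 \<noteq> i1"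
    and top: "\<bar>\<mu> i1\<bar> \<le> \<bar>\<mu> i0\<bar>" and snd: "\<And>i. i \<in> I \<Longrightarrow> i \<noteq> i0 \<Longrightarrow> \<bar>\<mu> i\<bar> \<le> \<bar>\<mu> i1\<bar>"
  shows "third_abs_eigenvalue (X \<union> Y) E = \<bar>\<mu> i1\<bar>"
proof -
  let ?M = "image_mset \<mu> (mset_set I) + image_mset (\<lambda>i. - \<mu> i) (mset_set I)"
  obtain S where S: "sorted_list_of_multiset ?M = [- \<bar>\<mu> i0\<bar>, - \<bar>\<mu> i1\<bar>] @ S @ [\<bar>\<mu> i1\<bar>, \<bar>\<mu> i0\<bar>]"
    using sorted_spectrum_symmetric[of I i0 i1 \<mu>] I(1) i top snd by blast
  have "card (X \<union> Y) = size ?M"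
    using bip I by (simp add: bipartite_graph_def card_Un_disjoint)
  also have "\<dots> = length (sorted_list_of_multiset ?M)"
    by (metis mset_sorted_list_of_multiset size_mset)
  \<comment> \<open>With four entries outside \<open>S\<close>, the second and the second-to-last
    positions are distinct and hold plus and minus \<open>\<bar>\<mu> i1\<bar>\<close>.\<close>
  finally have card: "card (X \<union> Y) = length S + 4" by (simp add: S)
  have "graph_spectrum (X \<union> Y) E = [\<bar>\<mu> i0\<bar>, \<bar>\<mu> i1\<bar>] @ rev S @ [- \<bar>\<mu> i1\<bar>, - \<bar>\<mu> i0\<bar>]"
    by (simp add: graph_spectrum_def proots_adjacency_bipartite[OF bip I sys] S)
  then show ?thesis
    by (simp add: third_abs_eigenvalue_def graph_eigenvalue_def card nth_append)
qed

subsection \<open>Regular bipartite graphs and their threshold powers\<close>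

lemma singular_system_cong:
  assumes "\<And>x y. x \<in> X \<Longrightarrow> y \<in> Y \<Longrightarrow> B x y = B' x y"
  shows "singular_system X Y B I \<sigma> u v = singular_system X Y B' I \<sigma> u v"
  using assms by (simp add: singular_system_def cong: sum.cong)

text \<open>The quotient of binomials is exactly the ratio of \<open>k choose (t + l)\<close> to
  \<open>k choose t\<close>. Replacing \<open>l\<close> factors \<open>p\<close> by the larger
  \<open>q\<close> then compares every summand with the first one, \<open>W\<close>.\<close>

lemma binomial_tail_bounds:
  fixes p q :: real
  assumes t: "t \<le> k" and pq: "0 \<le> p" "p \<le> q"
  defines "W \<equiv> real (k choose t) * p ^ t * q ^ (k - t)"
    and "T \<equiv> \<Sum>t'=t..k. real (k choose t') * p ^ t' * q ^ (k - t')"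
  shows "W \<le> T"
    and "T \<le> (\<Sum>l=0..k - t. real ((k - t) choose l) / real ((t + l) choose l)) * W"
proof -
  show "W \<le> T"
    unfolding W_def T_def
    using t pq by (intro member_le_sum[where f = "\<lambda>t'. real (k choose t') * p ^ t' * q ^ (k - t')"]) auto
  have "T = (\<Sum>l=0..k - t. real (k choose (t + l)) * p ^ (t + l) * q ^ (k - (t + l)))"
    unfolding T_def using t sum.shift_bounds_cl_nat_ivl[of _ 0 t "k - t"] by (simp add: add.commute)
  also have "\<dots> \<le> (\<Sum>l=0..k - t. real ((k - t) choose l) / real ((t + l) choose l) * W)"
  proof (rule sum_mono)
    fix l assume "l \<in> {0..k - t}"
    then have l: "t + l \<le> k" using t by auto
    have "(k choose (t + l)) * ((t + l) choose t) = (k choose t) * ((k - t) choose l)"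
      using choose_mult[of t "t + l" k] l by simp
    moreover have "(t + l) choose t = (t + l) choose l"
      using binomial_symmetric[of t "t + l"] by simp
    ultimately have "real (k choose (t + l)) * real ((t + l) choose l) = real (k choose t) * real ((k - t) choose l)"
      by (metis of_nat_mult)
    moreover have "real ((t + l) choose l) > 0" by simp
    ultimately have C: "real (k choose (t + l)) = real ((k - t) choose l) / real ((t + l) choose l) * real (k choose t)"
      by (simp add: field_simps)
    have "p ^ (t + l) * q ^ (k - (t + l)) \<le> p ^ t * q ^ l * q ^ (k - (t + l))"
      unfolding power_add using pq by (intro mult_right_mono mult_left_mono power_mono) auto
    also have "\<dots> = p ^ t * q ^ (k - t)"
      using l by (simp add: mult.assoc flip: power_add)
    finally have "real (k choose (t + l)) * (p ^ (t + l) * q ^ (k - (t + l))) \<le>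
        real (k choose (t + l)) * (p ^ t * q ^ (k - t))"
      by (rule mult_left_mono) simp
    then show "real (k choose (t + l)) * p ^ (t + l) * q ^ (k - (t + l)) \<le>
        real ((k - t) choose l) / real ((t + l) choose l) * W"
      by (simp add: C W_def mult_ac)
  qed
  finally show "T \<le> (\<Sum>l=0..k - t. real ((k - t) choose l) / real ((t + l) choose l)) * W"
    by (simp add: sum_distrib_right)
qed

lemma regular_bipartite_sums:
  assumes bip: "bipartite_graph X Y E" and reg: "regular_graph (X \<union> Y) E d"
  shows "\<And>x. x \<in> X \<Longrightarrow> (\<Sum>y\<in>Y. if {x, y} \<in> E then 1 else 0) = real d"
    and "\<And>y. y \<in> Y \<Longrightarrow> (\<Sum>x\<in>X. if {x, y} \<in> E then 1 else 0) = real d"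
proof -
  have fin: "finite X" "finite Y" and dis: "X \<inter> Y = {}"
    and E: "E \<subseteq> {{x, y} | x y. x \<in> X \<and> y \<in> Y}"
    using bip by (auto simp: bipartite_graph_def)
  have noE: "{x, x'} \<notin> E" if "x \<in> X \<and> x' \<in> X \<or> x \<in> Y \<and> x' \<in> Y" for x x'
    using E dis that by (auto simp: doubleton_eq_iff dest!: subsetD)
  show "(\<Sum>y\<in>Y. if {x, y} \<in> E then 1 else 0) = real d" if "x \<in> X" for x
  proof -
    have "{u \<in> X \<union> Y. {x, u} \<in> E} = {y \<in> Y. {x, y} \<in> E}" using noE that by auto
    moreover have "card {u \<in> X \<union> Y. {x, u} \<in> E} = d"
      using reg that unfolding regular_graph_def by blast
    ultimately have "card {y \<in> Y. {x, y} \<in> E} = d" by (simp only:)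
    then show ?thesis using fin by (simp add: sum.If_cases Int_def)
  qed
  show "(\<Sum>x\<in>X. if {x, y} \<in> E then 1 else 0) = real d" if "y \<in> Y" for y
  proof -
    have "{u \<in> X \<union> Y. {y, u} \<in> E} = {x \<in> X. {x, y} \<in> E}"
      using noE that by (auto simp: insert_commute)
    moreover have "card {u \<in> X \<union> Y. {y, u} \<in> E} = d"
      using reg that unfolding regular_graph_def by blast
    ultimately have "card {x \<in> X. {x, y} \<in> E} = d" by (simp only:)
    then show ?thesis using fin by (simp add: sum.If_cases Int_def)
  qed
qed

text \<open>Double counting of the edges.\<close>

lemma regular_bipartite_card_eq:
  assumes bip: "bipartite_graph X Y E" and reg: "regular_graph (X \<union> Y) E d" and d: "0 < d"
  shows "card X = card Y"
proof -
  have "real d * card X = (\<Sum>x\<in>X. \<Sum>y\<in>Y. if {x, y} \<in> E then 1 else 0)"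
    using regular_bipartite_sums(1)[OF bip reg] by simp
  also have "\<dots> = (\<Sum>y\<in>Y. \<Sum>x\<in>X. if {x, y} \<in> E then 1 else 0)" by (rule sum.swap)
  also have "\<dots> = real d * card Y"
    using regular_bipartite_sums(2)[OF bip reg] by simp
  finally show ?thesis using d by simp
qed

section \<open>The threshold power as a bipartite graph and its third eigenvalue\<close>

lemma tuples_disjoint:
  assumes "X \<inter> Y = {}" "1 \<le> k"
  shows "tuples k X \<inter> tuples k Y = {}"
proof -
  \<comment> \<open>A common tuple would have its first entry in both classes;
    \<open>k \<ge> 1\<close> provides this entry.\<close>
  have False if "xs \<in> tuples k X" "xs \<in> tuples k Y" for xs
    using that assms by (cases xs) (auto simp: tuples_def)
  then show ?thesis by blast
qed

lemma bipartite_graph_bgp: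
  assumes "bipartite_graph X Y E" "1 \<le> k"
  shows "bipartite_graph (tuples k X) (tuples k Y) (bgp_edges k t X Y E)"
proof -
  have "bgp_edges k t X Y E \<subseteq> {{xs, ys} | xs ys. xs \<in> tuples k X \<and> ys \<in> tuples k Y}"
    unfolding bgp_edges_def by blast
  then show ?thesis
    using assms tuples_disjoint[of X Y k] by (simp add: bipartite_graph_def finite_tuples)
qed

text \<open>Edges are unordered pairs. Disjointness of the classes recovers which end is
  \<open>xs\<close> and which is \<open>ys\<close>.\<close>

lemma bgp_edges_iff:
  assumes "X \<inter> Y = {}" "1 \<le> k" and xy: "xs \<in> tuples k X" "ys \<in> tuples k Y"
  shows "{xs, ys} \<in> bgp_edges k t X Y E \<longleftrightarrow> t \<le> card {i. i < k \<and> {xs ! i, ys ! i} \<in> E}"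
proof -
  have "xs' = xs \<and> ys' = ys" if "{xs, ys} = {xs', ys'}" "xs' \<in> tuples k X" "ys' \<in> tuples k Y" for xs' ys'
    using that xy tuples_disjoint[OF assms(1,2)] by (auto simp: doubleton_eq_iff)
  note eq = this
  show ?thesis
  proof
    assume "{xs, ys} \<in> bgp_edges k t X Y E"
    then obtain xs' ys' where "{xs, ys} = {xs', ys'}" "xs' \<in> tuples k X" "ys' \<in> tuples k Y"
      and *: "t \<le> card {i. i < k \<and> {xs' ! i, ys' ! i} \<in> E}"
      unfolding bgp_edges_def by (elim CollectE exE conjE)
    then have "xs' = xs" "ys' = ys" using eq by simp_all
    with * show "t \<le> card {i. i < k \<and> {xs ! i, ys ! i} \<in> E}" by simp
  next
    assume "t \<le> card {i. i < k \<and> {xs ! i, ys ! i} \<in> E}"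
    with xy show "{xs, ys} \<in> bgp_edges k t X Y E"
      unfolding bgp_edges_def by (intro CollectI exI conjI) (rule refl)
  qed
qed

text \<open>The all-constant index tuple carries the largest value. Every other tuple contains a
  nonconstant index, and the largest absolute value among these is reached with one such index of
  maximal \<open>\<bar>\<sigma> i\<bar>\<close> and constant indices elsewhere.\<close>

lemma third_abs_eigenvalue_bgp:
  fixes E :: "'a set set"
  assumes t: "1 \<le> t" "t \<le> k" and bip: "bipartite_graph X Y E" and n: "card (X \<union> Y) = n"
    and reg: "regular_graph (X \<union> Y) E d" and d: "0 < d" "real d \<le> real n / 4"
  shows "third_abs_eigenvalue (tuples k X \<union> tuples k Y) (bgp_edges k t X Y E) =
    third_abs_eigenvalue (X \<union> Y) E *
      (real ((k - 1) choose (t - 1)) * real d ^ (t - 1) * (real n / 2 - real d) ^ (k - t))"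
    and "0 \<le> third_abs_eigenvalue (X \<union> Y) E"
proof -
  have k: "1 \<le> k" using t by simp
  have fin: "finite X" "finite Y" and dis: "X \<inter> Y = {}"
    using bip by (auto simp: bipartite_graph_def)
  define m where "m = card X"
  have m: "card X = m" "card Y = m"
    using regular_bipartite_card_eq[OF bip reg d(1)] by (simp_all add: m_def)
  have nm: "real n / 2 = real m" using n m fin dis by (auto simp: card_Un_disjoint)
  have m2: "2 * real d \<le> real m" using d nm by simp
  \<comment> \<open>This guarantees a nonconstant index, so the maximum over \<open>{1..<m}\<close>
    exists.\<close>
  then have "2 \<le> m" using d(1) by linarith
  then have m0: "0 < m" by simp
  define B :: "'a \<Rightarrow> 'a \<Rightarrow> real" where "B = (\<lambda>x y. if {x, y} \<in> E then 1 else 0)"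
  have row: "(\<Sum>y\<in>Y. B x y) = real d" if "x \<in> X" for x
    using regular_bipartite_sums(1)[OF bip reg that] by (simp add: B_def)
  have col: "(\<Sum>x\<in>X. B x y) = real d" if "y \<in> Y" for y
    using regular_bipartite_sums(2)[OF bip reg that] by (simp add: B_def)
  obtain \<sigma> u v where sys: "singular_system X Y B {..<m} \<sigma> u v" and \<sigma>0: "\<sigma> 0 = real d"
    and u0: "\<And>x. u 0 x = 1 / sqrt m" and v0: "\<And>y. v 0 y = 1 / sqrt m"
    using regular_singular_system[OF fin m m0 row col] by blast
  have \<sigma>: "\<bar>\<sigma> i\<bar> \<le> d" if "i < m" for i
    by (rule singular_value_le_degree[OF sys _ _ row col]) (use that in \<open>auto simp: B_def\<close>)
  have "{1..<m} \<noteq> {}" using \<open>2 \<le> m\<close> by auto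
  then have "Max ((\<lambda>i. \<bar>\<sigma> i\<bar>) ` {1..<m}) \<in> (\<lambda>i. \<bar>\<sigma> i\<bar>) ` {1..<m}"
    by (intro Max_in) auto
  then obtain i1 where i1: "1 \<le> i1" "i1 < m" and max: "\<bar>\<sigma> i1\<bar> = Max ((\<lambda>i. \<bar>\<sigma> i\<bar>) ` {1..<m})"
    by auto
  have \<sigma>1: "\<bar>\<sigma> i\<bar> \<le> \<bar>\<sigma> i1\<bar>" if "i < m" "i \<noteq> 0" for i
    unfolding max using that by (intro Max_ge) auto
  have lam: "third_abs_eigenvalue (X \<union> Y) E = \<bar>\<sigma> i1\<bar>"
    by (rule third_abs_eigenvalue_bipartite[OF bip _ _ _ sys[unfolded B_def], of 0])
      (use m i1 \<sigma> \<sigma>1 \<sigma>0 in auto)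
  then show "0 \<le> third_abs_eigenvalue (X \<union> Y) E" by simp
  define c where "c = (\<lambda>i. if i = 0 then real m - \<sigma> 0 else - \<sigma> i)"
  define q where "q = real m - real d"
  have q: "real d \<le> q" using m2 by (simp add: q_def)
  \<comment> \<open>The density bound enters here: at nonconstant indices
    \<open>\<bar>c i\<bar>\<close> is at most \<open>d\<close>, and
    \<open>d \<le> m - d = q\<close>.\<close>
  have c: "\<bar>c i\<bar> \<le> q" if "i < m" for i
    using \<sigma>[OF that] q by (auto simp: c_def \<sigma>0 q_def)
  let ?I = "tuples k {..<m}" and ?T = "tail_coeff \<sigma> c t"
  let ?B = "\<lambda>xs ys. if {xs, ys} \<in> bgp_edges k t X Y E then 1 else 0 :: real"
  have "singular_system (tuples k X) (tuples k Y) (threshold B t) ?I ?T (tensor u) (tensor v)"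
    unfolding c_def
    by (rule singular_system_threshold[OF fin sys singular_system_complement[OF fin m m0 sys u0 v0]])
  moreover have "threshold B t xs ys = ?B xs ys" if "xs \<in> tuples k X" "ys \<in> tuples k Y" for xs ys
    using that bgp_edges_iff[OF dis k that] threshold_eq[of xs ys "\<lambda>x y. {x, y} \<in> E"]
    by (simp add: B_def tuples_def)
  then have "singular_system (tuples k X) (tuples k Y) (threshold B t) ?I ?T (tensor u) (tensor v) \<longleftrightarrow>
      singular_system (tuples k X) (tuples k Y) ?B ?I ?T (tensor u) (tensor v)"
    by (rule singular_system_cong)
  ultimately have bsys: "singular_system (tuples k X) (tuples k Y) ?B ?I ?T (tensor u) (tensor v)"
    by (simp only:)
  define K where "K = real ((k - 1) choose (t - 1)) * real d ^ (t - 1) * q ^ (k - t)"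
  have K: "coeff ([:q, real d:] ^ (k - 1)) (t - 1) = K"
    using t by (simp add: K_def coeff_linear_poly_power)
  have K0: "0 \<le> K" using q by (simp add: K_def)
  \<comment> \<open>\<open>z\<close> is the constant index tuple, and \<open>w\<close> changes its
    first entry to \<open>i1\<close>. They will be the places of the largest and the second largest
    absolute value.\<close>
  define z where "z = replicate k (0::nat)"
  define w where "w = i1 # replicate (k - 1) 0"
  have zw: "z \<in> ?I" "w \<in> ?I" "z \<noteq> w"
    using m0 i1 k by (auto simp: z_def w_def tuples_def) (cases k; simp)+
  have "?T w = \<sigma> i1 * coeff (\<Prod>j\<leftarrow>remove1 i1 w. [:c j, \<sigma> j:]) (t - 1)"
    by (rule tail_coeff_nontrivial) (use i1 t in \<open>auto simp: w_def c_def\<close>)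
  moreover have "(\<Prod>j\<leftarrow>remove1 i1 w. [:c j, \<sigma> j:]) = [:q, real d:] ^ (k - 1)"
    by (simp add: w_def c_def \<sigma>0 q_def)
  ultimately have Tw: "?T w = \<sigma> i1 * K" by (simp only: K)
  \<comment> \<open>One nonconstant index collapses the tail to a coefficient, and the remaining
    \<open>k - 1\<close> factors are dominated by \<open>q + d z\<close>, whose power has the
    coefficient \<open>K\<close>.\<close>
  have other: "\<bar>?T ix\<bar> \<le> \<bar>\<sigma> i1\<bar> * K" if ix: "ix \<in> ?I" "ix \<noteq> z" for ix
  proof -
    have len: "length ix = k" and lt: "\<And>i. i \<in> set ix \<Longrightarrow> i < m"
      using ix(1) by (auto simp: tuples_def)
    have "\<not> (\<forall>i\<in>set ix. i = 0)"
      using ix(2) replicate_eqI[OF len, of 0] by (auto simp only: z_def)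
    then obtain i where i: "i \<in> set ix" "i \<noteq> 0" by blast
    have "?T ix = \<sigma> i * coeff (\<Prod>j\<leftarrow>remove1 i ix. [:c j, \<sigma> j:]) (t - 1)"
      using i t by (intro tail_coeff_nontrivial) (auto simp: c_def)
    moreover have "\<bar>coeff (\<Prod>j\<leftarrow>remove1 i ix. [:c j, \<sigma> j:]) (t - 1)\<bar> \<le>
        coeff ([:q, real d:] ^ length (remove1 i ix)) (t - 1)"
      by (intro coeff_prod_list_le \<sigma> c lt) (auto dest: subsetD[OF set_remove1_subset])
    moreover have "length (remove1 i ix) = k - 1" using i len by (simp add: length_remove1)
    ultimately show ?thesis
      using \<sigma>1[OF lt[OF i(1)] i(2)] K by (auto simp: abs_mult intro!: mult_mono)
  qed
  \<comment> \<open>To see that \<open>z\<close> dominates \<open>w\<close>: \<open>d K\<close> is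
    at most the first summand of the tail sum \<open>?T z\<close>, because
    \<open>(k - 1) choose (t - 1)\<close> is at most \<open>k choose t\<close>.\<close>
  have "\<bar>\<sigma> i1\<bar> * K \<le> real d * K"
    using \<sigma>[OF i1(2)] K0 by (rule mult_right_mono)
  also have "\<dots> \<le> real (k choose t) * real d ^ t * q ^ (k - t)"
  proof -
    have "((k - 1) choose (t - 1)) \<le> (k choose t)"
      using t by (cases k; cases t) auto
    then have "real ((k - 1) choose (t - 1)) * (real d ^ t * q ^ (k - t)) \<le> real (k choose t) * (real d ^ t * q ^ (k - t))"
      using q by (intro mult_right_mono) auto
    moreover have "real d * real d ^ (t - 1) = real d ^ t" using t by (simp flip: power_Suc)
    then have "real d * K = real ((k - 1) choose (t - 1)) * (real d ^ t * q ^ (k - t))"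
      unfolding K_def by (metis mult.assoc mult.left_commute)
    ultimately show ?thesis by (simp only: mult.assoc)
  qed
  also have "\<dots> \<le> (\<Sum>t'=t..k. real (k choose t') * real d ^ t' * q ^ (k - t'))"
    by (rule binomial_tail_bounds(1)) (use t q in auto)
  also have "\<dots> = ?T z"
    by (simp add: tail_coeff_eq_sum z_def c_def \<sigma>0 coeff_linear_poly_power flip: q_def)
  finally have top: "\<bar>?T w\<bar> \<le> \<bar>?T z\<bar>" using K0 by (simp add: Tw abs_mult)
  have "third_abs_eigenvalue (tuples k X \<union> tuples k Y) (bgp_edges k t X Y E) = \<bar>?T w\<bar>"
  proof (rule third_abs_eigenvalue_bipartite[OF bipartite_graph_bgp[OF bip k] _ _ _ bsys zw top])
    show "\<bar>?T ix\<bar> \<le> \<bar>?T w\<bar>" if "ix \<in> ?I" "ix \<noteq> z" for ix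
      using other[OF that] K0 by (simp add: Tw abs_mult)
  qed (simp_all add: finite_tuples card_tuples fin m)
  then show "third_abs_eigenvalue (tuples k X \<union> tuples k Y) (bgp_edges k t X Y E) =
      third_abs_eigenvalue (X \<union> Y) E *
        (real ((k - 1) choose (t - 1)) * real d ^ (t - 1) * (real n / 2 - real d) ^ (k - t))"
    using K0 unfolding lam nm q_def[symmetric] K_def[symmetric] Tw by (simp add: abs_mult)
qed

text \<open>The exact value of \<open>Lam\<close> is \<open>lam / d * (t / k)\<close> times the
  first summand \<open>W\<close> of \<open>d2\<close>, so both bounds follow from
  \<open>W \<le> d2 \<le> \<alpha> * W\<close>.\<close>

theorem theorem6:
  fixes X Y :: "'a set" and E :: "'a set set" and k t n d :: nat
    and lam Lam d2 \<alpha> :: real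
  assumes "1 \<le> k" and "1 \<le> t" and "t \<le> k"
    and "bipartite_graph X Y E"
    and "card (X \<union> Y) = n"
    and "regular_graph (X \<union> Y) E d"
    and "0 < d"
    and "lam = third_abs_eigenvalue (X \<union> Y) E"
    and "Lam = third_abs_eigenvalue (tuples k X \<union> tuples k Y) (bgp_edges k t X Y E)"
    and "d2 = (\<Sum>t'=t..k. real (k choose t') * real d ^ t' * (real n / 2 - real d) ^ (k - t'))"
    and "\<alpha> = (\<Sum>l=0..k - t. real ((k - t) choose l) / real ((t + l) choose l))"
    and "real d \<le> real n / 4"
  shows "lam / real d * (1 / \<alpha>) * (real t / real k) * d2 \<le> Lam \<and> Lam \<le> lam / real d * d2"
proof -
  define q where "q = real n / 2 - real d"
  define W where "W = real (k choose t) * real d ^ t * q ^ (k - t)"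
  have q: "real d \<le> q" using assms(12) by (simp add: q_def)
  have Lam: "Lam = lam * (real ((k - 1) choose (t - 1)) * real d ^ (t - 1) * q ^ (k - t))"
    and lam: "0 \<le> lam"
    using third_abs_eigenvalue_bgp[OF assms(2-7,12)] unfolding assms(8,9) q_def by auto
  \<comment> \<open>The absorption identity produces the factor \<open>t / k\<close> of the lower
    bound.\<close>
  have "t * (k choose t) = k * ((k - 1) choose (t - 1))"
    using times_binomial_minus1_eq[of t k] assms(2) by simp
  then have "real t * real (k choose t) = real k * real ((k - 1) choose (t - 1))"
    by (metis of_nat_mult)
  then have C: "real ((k - 1) choose (t - 1)) = real t / real k * real (k choose t)"
    using assms(1) by (simp add: field_simps)
  have D: "real d ^ (t - 1) = real d ^ t / real d"
    using assms(2,7) by (simp add: power_diff)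
  have LamW: "Lam = lam / real d * (real t / real k) * W"
    unfolding Lam C D W_def by (simp add: mult_ac)
  have W: "W \<le> d2" "d2 \<le> \<alpha> * W"
    unfolding assms(10,11) W_def q_def[symmetric]
    using binomial_tail_bounds[of t k "real d" q] assms(3) q by auto
  have W0: "0 \<le> W" using q by (simp add: W_def)
  have "0 < \<alpha>" unfolding assms(11) by (intro sum_pos) auto
  then have "1 / \<alpha> * d2 \<le> W" using W(2) by (simp add: field_simps)
  then have "lam / real d * (real t / real k) * (1 / \<alpha> * d2) \<le> lam / real d * (real t / real k) * W"
    using lam by (intro mult_left_mono) auto
  \<comment> \<open>The upper bound drops the factor \<open>t / k \<le> 1\<close>.\<close>
  moreover have "lam / real d * (real t / real k * W) \<le> lam / real d * d2"
  proof (intro mult_left_mono)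
    have "real t / real k * W \<le> 1 * W"
      using assms(1,3) W0 by (intro mult_right_mono) auto
    then show "real t / real k * W \<le> d2" using W(1) by simp
  qed (use lam in simp)
  ultimately show ?thesis by (simp add: LamW mult_ac)
qed

end
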